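(* Let $A$, $B$ and $C$ be three rings, with $B$ and $C$ commutative. Let $n,m\in\mathbb{N}$. Let $f:B\to C$ be an $n$-homomorphism, and let $g:A\to B$ be an $m$-homomorphism. Then $f\circ g:A\to C$ is an $nm$-homomorphism.
   Context: Rings are associative and unital, not necessarily commutative. $\mathbb{N}=\{0,1,2,\ldots\}$, $[n]=\{1,2,\ldots,n\}$, and $S_n$ is the group of permutations of $[n]$; $(-1)^\sigma$ is the sign of $\sigma$. A cycle of a permutation $\sigma$ is a tuple $(i_1,\ldots,i_k)$ of distinct elements with $\sigma(i_j)=i_{j+1}$ for $j<k$ and $\sigma(i_k)=i_1$, considered up to cyclic rotation; fixed points count as $1$-cycles. Let $A$ be a ring, $B$ a commutative ring, and $f:A\to B$ a $\mathbb{Z}$-linear map (not required to be unital or multiplicative). We say $f$ is central if $f(aa')=f(a'a)$ for all $a,a'\in A$. If $f$ is central and $n\in\mathbb{N}$, the $n$-Frobenius map of $f$ is the $\mathbb{Z}$-multilinear map $f_n:A^n\to B$ given by $$f_n(a_1,\ldots,a_n)=\sum_{\sigma\in S_n}(-1)^\sigma\prod_{\substack{c=(i_1,i_2,\ldots,i_k)\\ \text{is a cycle of }\sigma}}f(a_{i_1}a_{i_2}\cdots a_{i_k})$$ (well-defined since $f$ is central; in particular $f_0()=1$ and $f_1=f$). For $n\in\mathbb{N}$, a $\mathbb{Z}$-linear map $f:A\to B$ is called an $n$-homomorphism if $f$ is central and $f_{n+1}=0$ identically. *)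

theory Defs
  imports Complex_Main "HOL-Combinatorics.Permutations"
begin

text \<open>
  Unital rings are rendered by the sort \<open>{ring, monoid_mult}\<close> and commutative unital rings by
  \<open>{comm_ring, comm_monoid_mult}\<close>.  Unlike \<open>ring_1\<close> and \<open>comm_ring_1\<close>, these sorts do not
  impose \<open>0 \<noteq> 1\<close>, so that the zero ring is included.
\<close>

text \<open>
  The tuples \<open>(i\<^sub>1, \<dots>, i\<^sub>k)\<close> are nonempty lists; \<open>map \<sigma> c = rotate1 c\<close> says
  \<open>\<sigma> i\<^sub>j = i\<^bsub>j+1\<^esub>\<close> for \<open>j < k\<close> and \<open>\<sigma> i\<^sub>k = i\<^sub>1\<close>.
\<close>

definition cycle_tuples :: "nat \<Rightarrow> (nat \<Rightarrow> nat) \<Rightarrow> nat list set" where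
  "cycle_tuples n \<sigma> =
     {c. c \<noteq> [] \<and> distinct c \<and> set c \<subseteq> {1..n} \<and> map \<sigma> c = rotate1 c}"

definition rotation_rel :: "(nat list \<times> nat list) set" where
  "rotation_rel = {(c, d). \<exists>k. d = rotate k c}"

definition cycles_of :: "nat \<Rightarrow> (nat \<Rightarrow> nat) \<Rightarrow> nat list set set" where
  "cycles_of n \<sigma> = cycle_tuples n \<sigma> // rotation_rel"

definition central :: "('a::{ring, monoid_mult} \<Rightarrow> 'b::{comm_ring, comm_monoid_mult}) \<Rightarrow> bool"
  where "central f \<longleftrightarrow> (\<forall>a a'. f (a * a') = f (a' * a))"

text \<open>
  Only the entries \<open>a 1, \<dots>, a n\<close> matter in \<open>frobenius_map n f a\<close>.  A cycle is a rotation class,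
  from which an arbitrary tuple is chosen; for central \<open>f\<close> the choice is irrelevant, see
  \<open>cycle_value_eq\<close> below.
\<close>

definition cycle_value ::
    "('a::{ring, monoid_mult} \<Rightarrow> 'b::{comm_ring, comm_monoid_mult}) \<Rightarrow> (nat \<Rightarrow> 'a) \<Rightarrow> nat list set \<Rightarrow> 'b"
  where "cycle_value f a C = f (prod_list (map a (SOME c. c \<in> C)))"

definition frobenius_map ::
    "nat \<Rightarrow> ('a::{ring, monoid_mult} \<Rightarrow> 'b::{comm_ring, comm_monoid_mult}) \<Rightarrow> (nat \<Rightarrow> 'a) \<Rightarrow> 'b"
  where "frobenius_map n f a =
    (\<Sum>\<sigma> | \<sigma> permutes {1..n}.
       (if evenperm \<sigma> then 1 else - 1) * (\<Prod>C\<in>cycles_of n \<sigma>. cycle_value f a C))"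

text \<open>\<open>additive f\<close> is \<open>\<int>\<close>-linearity.\<close>

definition n_homomorphism ::
    "nat \<Rightarrow> ('a::{ring, monoid_mult} \<Rightarrow> 'b::{comm_ring, comm_monoid_mult}) \<Rightarrow> bool"
  where "n_homomorphism n f \<longleftrightarrow>
    additive f \<and> central f \<and> (\<forall>a. frobenius_map (n + 1) f a = 0)"

lemma equiv_rotation_rel: "equiv UNIV rotation_rel"
proof (rule equivI)
  show "refl rotation_rel"
    unfolding rotation_rel_def by (auto intro!: refl_onI exI[of _ 0])
  show "sym rotation_rel"
  proof (rule symI)
    fix c d assume "(c, d) \<in> rotation_rel"
    then obtain k where d: "d = rotate k c"
      unfolding rotation_rel_def by blast
    have "rotate (length c - k mod length c) d = c"
    proof (cases "c = []")
      case False
      have "rotate (length c - k mod length c) d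
          = rotate (length c - k mod length c) (rotate (k mod length c) c)"
        using d rotate_conv_mod[of k c] by simp
      also have "\<dots> = rotate (length c) c"
        using False by (simp add: rotate_rotate less_imp_le)
      finally show ?thesis by simp
    qed (simp add: d)
    then show "(d, c) \<in> rotation_rel"
      unfolding rotation_rel_def by (auto intro: sym)
  qed
  show "trans rotation_rel"
    unfolding rotation_rel_def by (auto intro!: transI simp: rotate_rotate)
qed auto

lemma central_prod_list_rotate:
  assumes "central f"
  shows "f (prod_list (map a (rotate k c))) = f (prod_list (map a c))"
proof -
  have "f (prod_list (map a (rotate1 d))) = f (prod_list (map a d))" for d
    using assms by (cases d) (auto simp: central_def)
  then show ?thesis
    by (induction k) auto
qed

lemma cycle_value_eq:
  assumes "central f" and "C \<in> cycles_of n \<sigma>" and "c \<in> C"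
  shows "cycle_value f a C = f (prod_list (map a c))"
proof -
  obtain d where C: "C = rotation_rel `` {d}"
    using assms(2) unfolding cycles_of_def quotient_def by blast
  have "\<And>x. x \<in> C \<Longrightarrow> f (prod_list (map a x)) = f (prod_list (map a d))"
    using central_prod_list_rotate[OF assms(1)] unfolding C rotation_rel_def by auto
  moreover have "(SOME x. x \<in> C) \<in> C"
    using assms(3) by (rule someI)
  ultimately show ?thesis
    using assms(3) unfolding cycle_value_def by simp
qed

lemma frobenius_map_0: "frobenius_map 0 f a = 1"
proof -
  have "cycles_of 0 id = {}"
    by (auto simp: cycles_of_def cycle_tuples_def quotient_def)
  then show ?thesis
    by (simp add: frobenius_map_def evenperm_id)
qed

lemma frobenius_map_1:
  assumes "central f"
  shows "frobenius_map 1 f a = f (a 1)"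
proof -
  have "cycle_tuples 1 id = {[1]}"
  proof -
    have "c = [1]" if "c \<noteq> []" "distinct c" "set c \<subseteq> {1::nat}" for c
      using that by (cases c; cases "tl c") auto
    then show ?thesis unfolding cycle_tuples_def by auto
  qed
  then have cyc: "cycles_of 1 id = {rotation_rel `` {[1]}}"
    by (simp add: cycles_of_def quotient_def)
  have "[1] \<in> rotation_rel `` {[1]}"
    using equiv_rotation_rel by (auto simp: rotation_rel_def intro: exI[of _ 0])
  then have "cycle_value f a (rotation_rel `` {[1]}) = f (a 1)"
    using cycle_value_eq[OF assms, of _ 1 id "[1]"] cyc by simp
  then show ?thesis
    using cyc by (simp add: frobenius_map_def evenperm_id)
qed

end

theory Submission
  imports Defs "HOL-Library.Multiset" "HOL-Combinatorics.Cycles"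
begin

text \<open>
  Sorting permutations by the position of one index gives the recursion
  \<open>f\<^bsub>k+1\<^esub>(x, a\<^sub>1, \<dots>, a\<^sub>k) = f(x) f\<^sub>k(a\<^sub>1, \<dots>, a\<^sub>k) - (\<Sum>i. f\<^sub>k(a\<^sub>1, \<dots>, x a\<^sub>i, \<dots>, a\<^sub>k))\<close>.
  In particular \<open>f\<^bsub>n+1\<^esub> = 0\<close> forces \<open>f\<^sub>k = 0\<close> for all \<open>k > n\<close>.  By induction, the recursion
  and multilinearity yield
  \<open>(f \<circ> g)\<^sub>N(a) = (\<Sum>\<pi>. f\<^bsub>|\<pi>|\<^esub>(g\<^bsub>|P|\<^esub>(a\<^sub>P) : P \<in> \<pi>))\<close>,
  the sum ranging over all set partitions \<open>\<pi>\<close> of \<open>{1..N}\<close>.  For \<open>N = n m + 1\<close> every set partition has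
  more than \<open>n\<close> blocks or a block of size more than \<open>m\<close>, so every summand vanishes.
\<close>

section \<open>The recursion for Frobenius maps\<close>

text \<open>
  \<open>frob f a [i\<^sub>1, \<dots>, i\<^sub>k]\<close> is \<open>f\<^sub>k (a i\<^sub>1, \<dots>, a i\<^sub>k)\<close> for distinct indices; their type is arbitrary so
  that the blocks of a set partition can serve as indices.
\<close>

primrec frob ::
    "('a::{ring, monoid_mult} \<Rightarrow> 'b::{comm_ring, comm_monoid_mult}) \<Rightarrow> ('i \<Rightarrow> 'a) \<Rightarrow> 'i list \<Rightarrow> 'b"
  where
  "frob f a [] = 1"
| "frob f a (j # js) = f (a j) * frob f a js - (\<Sum>i\<in>set js. frob f (a(i := a j * a i)) js)"

lemma frob_cong:
  "(\<And>i. i \<in> set js \<Longrightarrow> a i = b i) \<Longrightarrow> frob f a js = frob f b js"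
proof (induction js arbitrary: a b)
  case (Cons j js)
  have "frob f (a(i := a j * a i)) js = frob f (b(i := b j * b i)) js" if "i \<in> set js" for i
    using Cons.prems that by (intro Cons.IH) auto
  moreover have "frob f a js = frob f b js"
    using Cons.prems by (intro Cons.IH) auto
  ultimately show ?case
    using Cons.prems by simp
qed simp

text \<open>Injectivity of \<open>h\<close> confines the update at \<open>h i\<close> to the index
  \<open>i\<close>. This serves to renumber index lists and to exchange a block of a partition for a
  larger one.\<close>

lemma frob_map:
  "inj_on h (set js) \<Longrightarrow> frob f a (map h js) = frob f (a \<circ> h) js"
proof (induction js arbitrary: a)
  case (Cons j js)
  have inj: "inj_on h (set js)"
    using Cons.prems by simp
  have "frob f (a(h i := a (h j) * a (h i))) (map h js)
      = frob f ((a \<circ> h)(i := (a \<circ> h) j * (a \<circ> h) i)) js" if "i \<in> set js" for i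
    unfolding Cons.IH[OF inj]
    using that inj by (intro frob_cong) (auto simp: inj_on_eq_iff)
  then show ?case
    using Cons.IH[OF inj] inj by (simp add: sum.reindex o_def)
qed simp

text \<open>Multilinearity, by induction along the recursion: as \<open>js\<close> is distinct, the
  varied entry enters each term exactly once.\<close>

lemma additive_frob:
  assumes "additive f" "distinct js" "k \<in> set js"
  shows "additive (\<lambda>u. frob f (a(k := u)) js)"
  using assms(2,3)
proof (induction js arbitrary: a k)
  case (Cons j js)
  interpret f: additive f by fact
  show ?case
  proof (rule additive.intro, goal_cases)
    case (1 u v)
    show ?case
    proof (cases "k = j")
      case True
      with Cons.prems have k: "k \<notin> set js" and js: "distinct js" by auto
      \<comment> \<open>Since \<open>k\<close> is not in \<open>js\<close>, the varied entry occurs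
        only in \<open>f w\<close> and as the left factor of \<open>w * a i\<close>.\<close>
      have head: "frob f (a(k := w)) (j # js)
          = f w * frob f a js - (\<Sum>i\<in>set js. frob f (a(i := w * a i)) js)" for w
      proof -
        have "frob f (a(k := w)) js = frob f a js"
          using k by (intro frob_cong) auto
        moreover have "frob f (a(k := w, i := w * (a(k := w)) i)) js = frob f (a(i := w * a i)) js"
          if "i \<in> set js" for i
          using k that by (intro frob_cong) auto
        ultimately show ?thesis
          using True by (simp del: fun_upd_apply add: fun_upd_same)
      qed
      have "frob f (a(i := (u + v) * a i)) js
          = frob f (a(i := u * a i)) js + frob f (a(i := v * a i)) js" if i: "i \<in> set js" for i
        unfolding distrib_right by (rule additive.add[OF Cons.IH[OF js i]])
      then show ?thesis
        unfolding head by (simp add: f.add distrib_right sum.distrib del: fun_upd_apply)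
    next
      case False
      with Cons.prems have k: "k \<in> set js" and js: "distinct js" by auto
      note add = additive.add[OF Cons.IH[OF js k]]
      have "frob f (a(k := u + v, i := a j * (a(k := u + v)) i)) js
          = frob f (a(k := u, i := a j * (a(k := u)) i)) js
          + frob f (a(k := v, i := a j * (a(k := v)) i)) js" for i
      proof (cases "i = k")
        case True
        then show ?thesis
          by (simp add: add distrib_left fun_upd_same del: fun_upd_apply)
      next
        case neq: False
        then show ?thesis
          using add[of "a(i := a j * a i)"] neq
          by (simp add: fun_upd_twist[OF neq] fun_upd_other del: fun_upd_apply)
      qed
      then show ?thesis
        using False
        by (simp add: add distrib_left sum.distrib fun_upd_other del: fun_upd_apply)
    qed
  qed
qed simp

section \<open>Cycles of a permutation as rotation classes of tuples\<close>

lemma rotate_in_cycle_tuples: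
  "c \<in> cycle_tuples n \<sigma> \<Longrightarrow> rotate k c \<in> cycle_tuples n \<sigma>"
  by (simp add: cycle_tuples_def rotate_map[symmetric] rotate1_rotate_swap)

text \<open>The bound includes \<open>k = length c\<close>, where the walk returns to the head;
  comparing the lengths of two tuples rests on this case.\<close>

lemma cycle_tuples_nth:
  assumes "c \<in> cycle_tuples n \<sigma>" "k \<le> length c"
  shows "(\<sigma> ^^ k) (hd c) = c ! (k mod length c)"
  using assms(2)
proof (induction k)
  case 0
  then show ?case
    using assms(1) by (simp add: cycle_tuples_def hd_conv_nth)
next
  case (Suc k)
  then have "(\<sigma> ^^ Suc k) (hd c) = map \<sigma> c ! k"
    by simp
  also have "\<dots> = rotate1 c ! k"
    using assms(1) by (simp add: cycle_tuples_def)
  also have "\<dots> = c ! (Suc k mod length c)"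
    using Suc.prems by (simp add: nth_rotate1)
  finally show ?case .
qed

text \<open>A cycle tuple lists the orbit of its head up to the first return. If one tuple were
  shorter, the longer one would repeat its head.\<close>

lemma cycle_tuples_eq_if_hd_eq:
  assumes "c \<in> cycle_tuples n \<sigma>" "d \<in> cycle_tuples n \<sigma>" "hd c = hd d"
  shows "c = d"
proof -
  have le: "length d \<le> length c"
    if c: "c \<in> cycle_tuples n \<sigma>" and d: "d \<in> cycle_tuples n \<sigma>" and hd: "hd c = hd d" for c d
  proof (rule ccontr)
    assume "\<not> ?thesis"
    then have len: "length c < length d"
      by simp
    then have "d ! length c = (\<sigma> ^^ length c) (hd d)"
      using cycle_tuples_nth[OF d, of "length c"] by simp
    also have "\<dots> = d ! 0"
      using cycle_tuples_nth[OF c, of "length c"] c d hd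
      by (simp add: cycle_tuples_def hd_conv_nth)
    finally have "length c = 0"
      using len d by (simp add: cycle_tuples_def nth_eq_iff_index_eq)
    then show False
      using c by (simp add: cycle_tuples_def)
  qed
  have "length c = length d"
    using le[OF assms] le[OF assms(2,1)] assms(3) by simp
  then show ?thesis
    using cycle_tuples_nth[OF assms(1)] cycle_tuples_nth[OF assms(2)] assms(3)
    by (intro nth_equalityI) (metis less_imp_le mod_less)+
qed

lemma ex_rotate_Cons:
  assumes "x \<in> set c"
  shows "\<exists>k t. rotate k c = x # t"
proof -
  obtain r s where "c = r @ x # s"
    using assms by (meson split_list)
  then have "rotate (length r) c = x # s @ r"
    by (simp add: rotate_append)
  then show ?thesis
    by blast
qed

text \<open>Rotating both tuples to bring \<open>x\<close> to the front makes their heads equal,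
  hence the rotated tuples too.\<close>

lemma cycle_tuples_meet_imp_rotation:
  assumes c: "c \<in> cycle_tuples n \<sigma>" and d: "d \<in> cycle_tuples n \<sigma>"
    and x: "x \<in> set c" "x \<in> set d"
  shows "(c, d) \<in> rotation_rel"
proof -
  obtain k l s t where kl: "rotate k c = x # s" "rotate l d = x # t"
    using ex_rotate_Cons x by metis
  have "rotate k c = rotate l d"
    using rotate_in_cycle_tuples[OF c, of k] rotate_in_cycle_tuples[OF d, of l] kl
    by (metis cycle_tuples_eq_if_hd_eq list.sel(1))
  then have "(c, rotate k c) \<in> rotation_rel" "(d, rotate k c) \<in> rotation_rel"
    unfolding rotation_rel_def by blast+
  then show ?thesis
    using equiv_rotation_rel by (meson equivE symD transD)
qed

text \<open>The witness is \<open>support \<sigma> x\<close>, the iterates of \<open>x\<close>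
  listed until the first return.\<close>

lemma ex_cycle_tuple:
  assumes "\<sigma> permutes {1..n}" "x \<in> {1..n}"
  shows "\<exists>t. x # t \<in> cycle_tuples n \<sigma>"
proof -
  have perm: "permutation \<sigma>"
    using assms(1) by (meson finite_atLeastAtMost permutes_imp_permutation)
  let ?p = "least_power \<sigma> x"
  let ?c = "support \<sigma> x"
  have p: "?p > 0" "(\<sigma> ^^ ?p) x = x"
    using least_power_of_permutation[OF perm] by auto
  have "(\<sigma> ^^ k) x \<in> {1..n}" for k
    using assms permutes_in_image[OF permutes_funpow[OF assms(1)]] by blast
  then have sub: "set ?c \<subseteq> {1..n}"
    by auto
  have "map \<sigma> ?c = rotate1 ?c"
  proof (rule nth_equalityI)
    fix k assume k: "k < length (map \<sigma> ?c)"
    show "map \<sigma> ?c ! k = rotate1 ?c ! k"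
    proof (cases "Suc k = ?p")
      case True
      then have "map \<sigma> ?c ! k = (\<sigma> ^^ ?p) x"
        using k by (metis (no_types, lifting) comp_apply diff_zero funpow.simps(2) length_map length_upt
            nth_map nth_upt plus_nat.add_0)
      then show ?thesis
        using True k p by (simp add: nth_rotate1)
    qed (use k in \<open>auto simp: nth_rotate1\<close>)
  qed simp
  then have "?c \<in> cycle_tuples n \<sigma>"
    using sub p(1) cycle_of_permutation[OF perm] by (auto simp: cycle_tuples_def)
  moreover have "?c = x # tl ?c"
    using p(1) by (simp add: upt_conv_Cons)
  ultimately show ?thesis
    by metis
qed

lemma finite_cycle_tuples: "finite (cycle_tuples n \<sigma>)"
  by (rule finite_subset[OF _ finite_subset_distinct[of "{1..n}"]]) (auto simp: cycle_tuples_def)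

text \<open>All tuples through \<open>x\<close> form a single rotation class. Splitting it off
  leaves the tuples avoiding \<open>x\<close>, which two permutations can share.\<close>

lemma prod_cycles_of_split:
  assumes f: "central f" and c: "c \<in> cycle_tuples n \<sigma>" "x \<in> set c"
  shows "(\<Prod>C\<in>cycles_of n \<sigma>. cycle_value f a C) = f (prod_list (map a c))
    * (\<Prod>C\<in>{d \<in> cycle_tuples n \<sigma>. x \<notin> set d} // rotation_rel. cycle_value f a C)"
proof -
  let ?R = "{d \<in> cycle_tuples n \<sigma>. x \<notin> set d} // rotation_rel"
  let ?C = "rotation_rel `` {c}"
  have cC: "c \<in> ?C"
    using equiv_class_self[OF equiv_rotation_rel] by simp
  have "rotation_rel `` {d} = ?C" if "d \<in> cycle_tuples n \<sigma>" "x \<in> set d" for d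
    using cycle_tuples_meet_imp_rotation[OF that(1) c(1) that(2) c(2)]
      equiv_class_eq[OF equiv_rotation_rel] by blast
  then have eq: "cycles_of n \<sigma> = insert ?C ?R"
    using c(1) unfolding cycles_of_def quotient_def by blast
  have "?C \<notin> ?R"
  proof
    assume "?C \<in> ?R"
    then obtain d where d: "x \<notin> set d" "?C = rotation_rel `` {d}"
      unfolding quotient_def by auto
    then have "(d, c) \<in> rotation_rel"
      using cC by blast
    then show False
      using d(1) c(2) by (auto simp: rotation_rel_def)
  qed
  moreover have "finite ?R"
    using finite_cycle_tuples[of n \<sigma>] by (simp add: quotient_def)
  moreover have "cycle_value f a ?C = f (prod_list (map a c))"
    using cycle_value_eq[OF f, of ?C n \<sigma> c] cC eq by simp
  ultimately show ?thesis
    unfolding eq by simp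
qed

section \<open>Cycle products after inserting a new index\<close>

lemma cycle_value_cong:
  assumes "central f" "C \<in> cycles_of n \<sigma>" "\<And>c i. c \<in> C \<Longrightarrow> i \<in> set c \<Longrightarrow> a i = b i"
  shows "cycle_value f a C = cycle_value f b C"
proof -
  obtain c where c: "c \<in> C"
    using assms(2) equiv_class_self[OF equiv_rotation_rel]
    unfolding cycles_of_def quotient_def by blast
  have "map a c = map b c"
    using assms(3)[OF c] by simp
  then show ?thesis
    using cycle_value_eq[OF assms(1,2) c] by metis
qed

lemma prod_cycles_of_fixpoint:
  assumes f: "central f" and q: "q permutes {1..n}"
  shows "(\<Prod>C\<in>cycles_of (Suc n) q. cycle_value f a C)
    = f (a (Suc n)) * (\<Prod>C\<in>cycles_of n q. cycle_value f a C)"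
proof -
  have "q (Suc n) = Suc n"
    using q by (simp add: permutes_def)
  then have c: "[Suc n] \<in> cycle_tuples (Suc n) q"
    by (simp add: cycle_tuples_def)
  have "{d \<in> cycle_tuples (Suc n) q. Suc n \<notin> set d} = cycle_tuples n q"
    by (auto simp: cycle_tuples_def subset_iff le_Suc_eq)
  then show ?thesis
    using prod_cycles_of_split[OF f c, of "Suc n" a] by (simp add: cycles_of_def)
qed

text \<open>If \<open>b # t\<close> is a cycle of \<open>q\<close>, the composite has the cycle
  \<open>Suc n # b # t\<close> and otherwise the same cycles. The product
  \<open>a (Suc n) * a b\<close> absorbs the new entry into the one at \<open>b\<close>.\<close>

lemma prod_cycles_of_transpose:
  assumes f: "central f" and q: "q permutes {1..n}" and b: "b \<in> {1..n}"
  shows "(\<Prod>C\<in>cycles_of (Suc n) (transpose (Suc n) b \<circ> q). cycle_value f a C)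
    = (\<Prod>C\<in>cycles_of n q. cycle_value f (a(b := a (Suc n) * a b)) C)"
proof -
  let ?\<sigma> = "transpose (Suc n) b \<circ> q"
  let ?a = "a(b := a (Suc n) * a b)"
  have q_new: "q (Suc n) = Suc n"
    using q by (simp add: permutes_def)
  have \<sigma>_new: "?\<sigma> (Suc n) = b"
    using q_new by simp
  have inj: "inj ?\<sigma>"
    using permutes_inj[OF q] by (auto intro: inj_compose)
  obtain t where t: "b # t \<in> cycle_tuples n q"
    using ex_cycle_tuple[OF q b] by blast
  have bt: "distinct (b # t)" "set (b # t) \<subseteq> {1..n}" "map q (b # t) = t @ [b]"
    using t by (auto simp: cycle_tuples_def)
  have new: "Suc n # b # t \<in> cycle_tuples (Suc n) ?\<sigma>"
  proof -
    have "map ?\<sigma> (b # t) = map (transpose (Suc n) b) (t @ [b])"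
      using bt(3) by (metis map_map)
    also have "\<dots> = t @ [Suc n]"
      using bt by (auto intro!: map_idI simp: transpose_def)
    finally show ?thesis
      using bt \<sigma>_new by (auto simp: cycle_tuples_def)
  qed
  have rest: "{d \<in> cycle_tuples (Suc n) ?\<sigma>. Suc n \<notin> set d} = {d \<in> cycle_tuples n q. b \<notin> set d}"
    (is "?L = ?R")
  proof (intro set_eqI iffI)
    fix d assume "d \<in> ?L"
    then have d: "d \<noteq> []" "distinct d" "set d \<subseteq> {1..Suc n}" "map ?\<sigma> d = rotate1 d" "Suc n \<notin> set d"
      by (auto simp: cycle_tuples_def)
    have closed: "?\<sigma> ` set d = set d"
      using d(4) by (metis set_map set_rotate1)
    \<comment> \<open>Only \<open>Suc n\<close> is sent to \<open>b\<close>, so a cycle avoiding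
      \<open>Suc n\<close> avoids \<open>b\<close> as well.\<close>
    have "b \<notin> set d"
    proof
      assume "b \<in> set d"
      then obtain y where "y \<in> set d" "?\<sigma> y = b"
        using closed by (metis imageE)
      then show False
        using d(5) \<sigma>_new injD[OF inj] by metis
    qed
    moreover have "q y = ?\<sigma> y" if y: "y \<in> set d" for y
    proof -
      have "?\<sigma> y \<noteq> Suc n" "?\<sigma> y \<noteq> b"
        using imageI[OF y, of ?\<sigma>] unfolding closed using d(5) \<open>b \<notin> set d\<close> by auto
      then show ?thesis
        by (auto simp: transpose_def split: if_splits)
    qed
    then have "map q d = rotate1 d"
      using d(4) by (metis map_cong)
    moreover have "set d \<subseteq> {1..n}"
      using d(3,5) by (auto simp: subset_iff le_Suc_eq)
    ultimately show "d \<in> ?R"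
      using d by (simp add: cycle_tuples_def)
  next
    fix d assume "d \<in> ?R"
    then have d: "d \<noteq> []" "distinct d" "set d \<subseteq> {1..n}" "map q d = rotate1 d" "b \<notin> set d"
      by (auto simp: cycle_tuples_def)
    have "?\<sigma> y = q y" if y: "y \<in> set d" for y
    proof -
      have "q y \<in> set d"
        using y d(4) by (metis imageI set_map set_rotate1)
      then have "q y \<noteq> b" "q y \<noteq> Suc n"
        using d(3,5) by auto
      then show ?thesis
        by simp
    qed
    then have "map ?\<sigma> d = rotate1 d"
      using d(4) by (metis map_cong)
    then show "d \<in> ?L"
      using d by (auto simp: cycle_tuples_def)
  qed
  have "cycle_value f a C = cycle_value f ?a C"
    if C: "C \<in> {d \<in> cycle_tuples n q. b \<notin> set d} // rotation_rel" for C
  proof (rule cycle_value_cong[OF f])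
    show "C \<in> cycles_of n q"
      using C by (auto simp: cycles_of_def quotient_def)
    fix c i assume "c \<in> C" "i \<in> set c"
    then have "i \<noteq> b"
      using C by (auto simp: quotient_def rotation_rel_def)
    then show "a i = ?a i"
      by simp
  qed
  moreover have "map ?a t = map a t"
    using bt(1) by simp
  ultimately show ?thesis
    using prod_cycles_of_split[OF f new, of "Suc n" a] prod_cycles_of_split[OF f t, of b ?a] rest
    by (simp add: mult.assoc fun_upd_same del: fun_upd_apply map_eq_conv)
qed

text \<open>
  Every permutation of \<open>{1..n + 1}\<close> either fixes \<open>n + 1\<close> or arises from a permutation of \<open>{1..n}\<close>
  by inserting \<open>n + 1\<close> just before some \<open>b\<close> in its cycle, which flips the sign.
\<close>

lemma frobenius_map_Suc:
  assumes f: "central f"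
  shows "frobenius_map (Suc n) f a = f (a (Suc n)) * frobenius_map n f a
    - (\<Sum>b=1..n. frobenius_map n f (a(b := a (Suc n) * a b)))"
proof -
  let ?P = "{q. q permutes {1..n}}"
  let ?s = "\<lambda>\<sigma>. if evenperm \<sigma> then 1 else - 1 :: 'b"
  let ?F = "\<lambda>\<sigma>. ?s \<sigma> * (\<Prod>C\<in>cycles_of (Suc n) \<sigma>. cycle_value f a C)"
  have "{1..Suc n} = insert (Suc n) {1..n}"
    by auto
  then have "frobenius_map (Suc n) f a
      = (\<Sum>b\<in>insert (Suc n) {1..n}. \<Sum>q\<in>?P. ?F (transpose (Suc n) b \<circ> q))"
    using sum_over_permutations_insert[of "{1..n}" "Suc n" ?F] unfolding frobenius_map_def by simp
  \<comment> \<open>For \<open>b = Suc n\<close> the transposition is the identity, which leaves the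
    permutations fixing \<open>Suc n\<close>.\<close>
  also have "\<dots> = (\<Sum>q\<in>?P. ?F q) + (\<Sum>b=1..n. \<Sum>q\<in>?P. ?F (transpose (Suc n) b \<circ> q))"
    by simp
  also have "(\<Sum>q\<in>?P. ?F q) = f (a (Suc n)) * frobenius_map n f a"
    unfolding frobenius_map_def
    by (simp add: prod_cycles_of_fixpoint[OF f] sum_distrib_left mult.left_commute)
  finally have expand: "frobenius_map (Suc n) f a = f (a (Suc n)) * frobenius_map n f a
      + (\<Sum>b=1..n. \<Sum>q\<in>?P. ?F (transpose (Suc n) b \<circ> q))" .
  have "(\<Sum>q\<in>?P. ?F (transpose (Suc n) b \<circ> q))
      = - frobenius_map n f (a(b := a (Suc n) * a b))" if b: "b \<in> {1..n}" for b
  proof -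
    have "?s (transpose (Suc n) b \<circ> q) = - ?s q" if "q permutes {1..n}" for q
    proof -
      have "permutation q"
        using that by (meson finite_atLeastAtMost permutes_imp_permutation)
      then show ?thesis
        using b by (simp add: evenperm_comp permutation_swap_id evenperm_swap)
    qed
    then show ?thesis
      unfolding frobenius_map_def
      using b by (simp add: prod_cycles_of_transpose[OF f] sum_negf[symmetric] del: fun_upd_apply)
  qed
  then have "(\<Sum>b=1..n. \<Sum>q\<in>?P. ?F (transpose (Suc n) b \<circ> q))
      = - (\<Sum>b=1..n. frobenius_map n f (a(b := a (Suc n) * a b)))"
    unfolding sum_negf[symmetric] by (intro sum.cong refl)
  then show ?thesis
    unfolding expand by (simp only: diff_conv_add_uminus)
qed

text \<open>The list is reversed because \<open>frob\<close> unfolds at its head while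
  \<open>frobenius_map_Suc\<close> removes the largest index.\<close>

lemma frobenius_map_eq_frob:
  assumes "central f"
  shows "frobenius_map n f a = frob f a (rev [1..<Suc n])"
proof (induction n arbitrary: a)
  case 0
  then show ?case by (simp add: frobenius_map_0)
next
  case (Suc n)
  have "set (rev [1..<Suc n]) = {1..n}"
    by auto
  moreover have "rev [1..<Suc (Suc n)] = Suc n # rev [1..<Suc n]"
    by simp
  ultimately show ?case
    unfolding frobenius_map_Suc[OF assms] Suc.IH by (simp only: frob.simps)
qed

text \<open>Length \<open>n + 1\<close> is the defining identity up to renumbering; for longer lists
  every term of the recursion contains \<open>frob\<close> on a tail that still has more than
  \<open>n\<close> entries.\<close>

lemma n_homomorphism_frob_eq_0:
  assumes f: "n_homomorphism n f" and js: "distinct js" "n < length js"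
  shows "frob f a js = 0"
  using js
proof (induction js arbitrary: a)
  case (Cons j js)
  show ?case
  proof (cases "n < length js")
    case True
    then show ?thesis
      using Cons by simp
  next
    case False
    with Cons.prems have len: "length (j # js) = n + 1"
      by simp
    \<comment> \<open>The reversal and the shift by one match the indices of
      \<open>frobenius_map\<close>, which start at 1 and are read from the largest down.\<close>
    define h where "h i = rev (j # js) ! (i - 1)" for i
    have "map h [1..<Suc (n + 1)] = rev (j # js)"
      using len by (intro nth_equalityI) (auto simp: h_def simp del: upt_Suc)
    then have js_eq: "j # js = map h (rev [1..<Suc (n + 1)])"
      by (metis rev_map rev_rev_ident)
    then have "inj_on h (set (rev [1..<Suc (n + 1)]))"
      using Cons.prems(1) by (metis distinct_map)
    then have "frob f a (j # js) = frob f (a \<circ> h) (rev [1..<Suc (n + 1)])"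
      unfolding js_eq by (rule frob_map)
    also have "\<dots> = frobenius_map (n + 1) f (a \<circ> h)"
      using f by (intro frobenius_map_eq_frob[symmetric]) (simp add: n_homomorphism_def)
    finally have "frob f a (j # js) = frobenius_map (n + 1) f (a \<circ> h)" .
    then show ?thesis
      using f by (simp add: n_homomorphism_def)
  qed
qed simp

section \<open>Composition as a sum over set partitions\<close>

text \<open>Putting \<open>j\<close> at the head of the block lets the recursion of
  \<open>frob\<close> act on \<open>j\<close>.\<close>

definition add_to_block :: "'i \<Rightarrow> 'i list \<Rightarrow> 'i list \<Rightarrow> 'i list" where
  "add_to_block j Q R = (if R = Q then j # R else R)"

text \<open>Lists of lists allow the blocks to be indices and a partition to be the index list of an
  outer \<open>frob\<close>.\<close>

primrec set_partitions :: "'i list \<Rightarrow> 'i list list list" where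
  "set_partitions [] = [[]]"
| "set_partitions (j # js) =
     concat (map (\<lambda>p. ([j] # p) # map (\<lambda>Q. map (add_to_block j Q) p) p) (set_partitions js))"

text \<open>Nonempty disjoint blocks cannot coincide, so they qualify as distinct indices.\<close>

lemma set_partitions_distinct:
  assumes "mset (concat p) = mset js" "[] \<notin> set p" "distinct js"
  shows "distinct (concat p)" "distinct p"
proof -
  show d: "distinct (concat p)"
    using assms mset_eq_imp_distinct_iff by blast
  with assms(2) show "distinct p"
    by (auto simp: distinct_concat_iff removeAll_id)
qed

lemma set_partitions_mset:
  "distinct js \<Longrightarrow> p \<in> set (set_partitions js) \<Longrightarrow> mset (concat p) = mset js \<and> [] \<notin> set p"
proof (induction js arbitrary: p)
  case (Cons j js)
  then obtain q where q: "q \<in> set (set_partitions js)"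
    and p: "p = [j] # q \<or> (\<exists>Q\<in>set q. p = map (add_to_block j Q) q)"
    by auto
  have IH: "mset (concat q) = mset js" "[] \<notin> set q"
    using Cons q by auto
  from p show ?case
  proof
    assume "\<exists>Q\<in>set q. p = map (add_to_block j Q) q"
    then obtain Q where Q: "Q \<in> set q" "p = map (add_to_block j Q) q"
      by blast
    obtain r s where q_eq: "q = r @ Q # s"
      using Q(1) by (meson split_list)
    \<comment> \<open>Since \<open>Q\<close> occurs only once, \<open>j\<close> joins a single
      block.\<close>
    have "distinct q"
      using set_partitions_distinct[OF IH] Cons.prems by simp
    then have "map (add_to_block j Q) r = r" "map (add_to_block j Q) s = s"
      unfolding q_eq by (auto simp: add_to_block_def intro!: map_idI)
    then have "p = r @ (j # Q) # s"
      using Q q_eq by (simp add: add_to_block_def)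
    then show ?thesis
      using IH q_eq by auto
  qed (use IH in auto)
qed simp

lemma sum_list_concat_map:
  "(\<Sum>x\<leftarrow>concat (map g xs). F x) = (\<Sum>y\<leftarrow>xs. \<Sum>x\<leftarrow>g y. F x)"
  for F :: "'x \<Rightarrow> 'y::monoid_add"
  by (induction xs) auto

lemma sum_sum_list_swap:
  "(\<Sum>i\<in>A. \<Sum>x\<leftarrow>xs. F i x) = (\<Sum>x\<leftarrow>xs. \<Sum>i\<in>A. F i x)"
  for F :: "'i \<Rightarrow> 'x \<Rightarrow> 'y::comm_monoid_add"
  by (induction xs) (auto simp: sum.distrib)

text \<open>The recursion for \<open>g\<close> turns the sum over \<open>i\<close> in a block
  \<open>Q\<close> into a difference, and additivity in slot \<open>Q\<close> carries it through
  \<open>frob f\<close>. The leftover products assemble into the recursion at the singleton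
  \<open>[j]\<close>.\<close>

lemma frob_insert_into_partition:
  fixes f :: "'b::{comm_ring, comm_monoid_mult} \<Rightarrow> 'c::{comm_ring, comm_monoid_mult}"
    and g :: "'a::{ring, monoid_mult} \<Rightarrow> 'b"
  assumes f: "additive f" and j: "distinct (j # js)"
    and p: "mset (concat p) = mset js" "[] \<notin> set p"
  shows "f (g (a j)) * frob f (frob g a) p
      - (\<Sum>i\<in>set js. frob f (frob g (a(i := a j * a i))) p)
    = frob f (frob g a) ([j] # p)
      + (\<Sum>Q\<leftarrow>p. frob f (frob g a) (map (add_to_block j Q) p))"
proof -
  let ?G = "frob g a"
  have js: "distinct js" "j \<notin> set js"
    using j by auto
  note d = set_partitions_distinct[OF p js(1)]
  have un: "set js = (\<Union>Q\<in>set p. set Q)"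
    using p(1) by (metis set_concat set_mset_mset)
  have disj: "set Q \<inter> set R = {}" if "Q \<in> set p" "R \<in> set p" "Q \<noteq> R" for Q R
    using d(1) that by (auto simp: distinct_concat_iff)
  have block: "(\<Sum>i\<in>set Q. frob f (frob g (a(i := a j * a i))) p)
      = frob f (?G(Q := g (a j) * ?G Q)) p - frob f ?G (map (add_to_block j Q) p)"
    if Q: "Q \<in> set p" for Q
  proof -
    interpret slot: additive "\<lambda>u. frob f (?G(Q := u)) p"
      using additive_frob[OF f d(2) Q] .
    \<comment> \<open>Blocks are disjoint, so changing the entry at \<open>i\<close> affects only
      the value of \<open>Q\<close>.\<close>
    have "frob f (frob g (a(i := a j * a i))) p
        = frob f (?G(Q := frob g (a(i := a j * a i)) Q)) p" if i: "i \<in> set Q" for i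
    proof (rule frob_cong)
      fix R assume R: "R \<in> set p"
      show "frob g (a(i := a j * a i)) R = (?G(Q := frob g (a(i := a j * a i)) Q)) R"
      proof (cases "R = Q")
        case False
        then have "i \<notin> set R"
          using disj[OF Q R] i by auto
        then show ?thesis
          using False by (auto intro: frob_cong)
      qed simp
    qed
    then have "(\<Sum>i\<in>set Q. frob f (frob g (a(i := a j * a i))) p)
        = frob f (?G(Q := (\<Sum>i\<in>set Q. frob g (a(i := a j * a i)) Q))) p"
      by (simp add: slot.sum)
    \<comment> \<open>This is the recursion for \<open>g\<close> at \<open>j # Q\<close>, solved for
      its sum.\<close>
    also have "(\<Sum>i\<in>set Q. frob g (a(i := a j * a i)) Q) = g (a j) * ?G Q - ?G (j # Q)"
      by simp
    also have "frob f (?G(Q := g (a j) * ?G Q - ?G (j # Q))) p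
        = frob f (?G(Q := g (a j) * ?G Q)) p - frob f (?G(Q := ?G (j # Q))) p"
      by (rule slot.diff)
    also have "frob f (?G(Q := ?G (j # Q))) p = frob f ?G (map (add_to_block j Q) p)"
    proof -
      have "j \<notin> set R" if "R \<in> set p" for R
        using that js(2) un by auto
      \<comment> \<open>The new index \<open>j\<close> keeps the enlarged block apart from all old
        ones.\<close>
      then have "inj_on (add_to_block j Q) (set p)"
        by (force simp: inj_on_def add_to_block_def)
      then show ?thesis
        by (auto simp: frob_map add_to_block_def intro!: frob_cong)
    qed
    finally show ?thesis .
  qed
  have "(\<Sum>i\<in>set js. frob f (frob g (a(i := a j * a i))) p)
      = (\<Sum>Q\<in>set p. \<Sum>i\<in>set Q. frob f (frob g (a(i := a j * a i))) p)"
    unfolding un using disj by (intro sum.UNION_disjoint) auto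
  also have "\<dots> = (\<Sum>Q\<in>set p. frob f (?G(Q := g (a j) * ?G Q)) p)
      - (\<Sum>Q\<in>set p. frob f ?G (map (add_to_block j Q) p))"
    by (simp add: block sum_subtractf)
  \<comment> \<open>As \<open>frob g a [j] = g (a j)\<close>, the remaining products are those
    subtracted in the recursion for \<open>[j] # p\<close>.\<close>
  finally show ?thesis
    using d(2) by (simp add: sum_list_distinct_conv_sum_set)
qed

text \<open>Induction for all \<open>a\<close> at once, since the recursion alters the entries. Each
  partition of \<open>js\<close> contributes exactly its extensions by \<open>j\<close>.\<close>

theorem frob_comp:
  fixes f :: "'b::{comm_ring, comm_monoid_mult} \<Rightarrow> 'c::{comm_ring, comm_monoid_mult}"
    and g :: "'a::{ring, monoid_mult} \<Rightarrow> 'b"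
  assumes f: "additive f" and js: "distinct js"
  shows "frob (f \<circ> g) a js = (\<Sum>p\<leftarrow>set_partitions js. frob f (frob g a) p)"
  using js
proof (induction js arbitrary: a)
  case (Cons j js)
  let ?P = "set_partitions js"
  have js: "distinct js"
    using Cons.prems by simp
  have "frob (f \<circ> g) a (j # js) = (\<Sum>p\<leftarrow>?P. f (g (a j)) * frob f (frob g a) p
      - (\<Sum>i\<in>set js. frob f (frob g (a(i := a j * a i))) p))"
    by (simp add: Cons.IH[OF js] sum_sum_list_swap sum_list_const_mult sum_list_subtractf
        del: fun_upd_apply)
  also have "\<dots> = (\<Sum>p\<leftarrow>?P. frob f (frob g a) ([j] # p)
      + (\<Sum>Q\<leftarrow>p. frob f (frob g a) (map (add_to_block j Q) p)))"
    using set_partitions_mset[OF js] frob_insert_into_partition[OF f Cons.prems]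
    by (intro arg_cong[of _ _ sum_list] map_cong) auto
  also have "\<dots> = (\<Sum>p\<leftarrow>set_partitions (j # js). frob f (frob g a) p)"
    by (simp add: sum_list_concat_map comp_def del: frob.simps)
  finally show ?case .
qed simp

theorem theorem0p4:
  fixes f :: "'b::{comm_ring, comm_monoid_mult} \<Rightarrow> 'c::{comm_ring, comm_monoid_mult}"
    and g :: "'a::{ring, monoid_mult} \<Rightarrow> 'b"
    and n m :: nat
  assumes "n_homomorphism n f"
    and "n_homomorphism m g"
  shows "n_homomorphism (n * m) (f \<circ> g)"
proof -
  have f: "additive f" and g: "additive g" "central g"
    using assms by (auto simp: n_homomorphism_def)
  have add: "additive (f \<circ> g)"
    using f g(1) by (simp add: additive_def)
  have cent: "central (f \<circ> g)"
    using g(2) by (simp add: central_def)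
  have "frobenius_map (n * m + 1) (f \<circ> g) a = 0" for a
  proof -
    let ?js = "rev [1..<Suc (n * m + 1)]"
    have js: "distinct ?js" "length ?js = n * m + 1"
      by (auto simp del: upt_Suc)
    have "frob f (frob g a) p = 0" if "p \<in> set (set_partitions ?js)" for p
    proof -
      have p: "mset (concat p) = mset ?js" "[] \<notin> set p"
        using set_partitions_mset[OF js(1) that] by auto
      note d = set_partitions_distinct[OF p js(1)]
      show ?thesis
      proof (cases "n < length p")
        case True
        then show ?thesis
          using n_homomorphism_frob_eq_0[OF assms(1) d(2)] by blast
      next
        case False
        \<comment> \<open>Pigeonhole: at most \<open>n\<close> blocks of size at most
          \<open>m\<close> hold at most \<open>n * m\<close> indices, one too few.\<close>
        have "\<exists>Q\<in>set p. m < length Q"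
        proof (rule ccontr)
          assume "\<not> ?thesis"
          then have "sum_list (map length p) \<le> sum_list (map (\<lambda>_. m) p)"
            by (intro sum_list_mono) auto
          also have "\<dots> \<le> n * m"
            using False by (simp add: sum_list_triv)
          finally have "length (concat p) \<le> n * m"
            by (simp add: length_concat)
          moreover have "length (concat p) = n * m + 1"
            using p(1) js(2) by (metis size_mset)
          ultimately show False
            by simp
        qed
        then obtain Q where Q: "Q \<in> set p" "m < length Q"
          by blast
        have "frob g a Q = 0"
          using d(1) Q by (intro n_homomorphism_frob_eq_0[OF assms(2)]) (auto simp: distinct_concat_iff)
        \<comment> \<open>A vanishing block value is a zero argument of a map additive in that
          argument.\<close>
        then have "frob f (frob g a) p = frob f ((frob g a)(Q := 0)) p"
          by (metis fun_upd_triv)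
        also have "\<dots> = 0"
          using additive.zero[OF additive_frob[OF f d(2) Q(1)]] .
        finally show ?thesis .
      qed
    qed
    then have "(\<Sum>p\<leftarrow>set_partitions ?js. frob f (frob g a) p) = 0"
      by (simp only: cong: map_cong) simp
    then show ?thesis
      unfolding frobenius_map_eq_frob[OF cent] frob_comp[OF f js(1)] .
  qed
  with add cent show ?thesis
    by (simp add: n_homomorphism_def)
qed

end
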